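(* Let the number of coordinates $n$, the prior parameters $r\in(0,1)$ and $\tau^2>0$, and the true mean vector be fixed, and let $\rho\to 1$ with $\rho<1$. All convergences below are almost sure, with the data realised as $X_i=\theta_i+\sqrt{\rho}\,Z+\sqrt{1-\rho}\,Z_i$ for fixed i.i.d. standard normal variables $Z,Z_1,\dots,Z_n$ that do not depend on $\rho$. (1) If $n=2$: when the null model $M_0$ is true, $$P(M_0\mid \boldsymbol X)\to 1;$$ when $M_1$ or $M_2$ is true, for each $i\in\{1,2\}$, $$P(M_i\mid \boldsymbol X)-\Bigl(1+\exp\bigl\{-\tfrac12\,(X_i^2-X_{(-i)}^2)\bigr\}\Bigr)^{-1}\to 0,$$ where $X_{(-i)}$ denotes the coordinate of $\boldsymbol X=(X_1,X_2)$ other than $X_i$. (2) If $n>2$: for all $i,j\in\{0,1,\dots,n\}$, when model $M_j$ is true, $$P(M_i\mid \boldsymbol X)\to\begin{cases}1 & \text{if } i=j,\\ 0&\text{otherwise.}\end{cases}$$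
   Context: Setting. For $n\ge 2$ and $\rho\in[0,1)$, $\boldsymbol X=(X_1,\dots,X_n)'$ is multivariate normal with mean $\boldsymbol\theta=(\theta_1,\dots,\theta_n)'$ and covariance matrix $\Sigma_0$ having all diagonal entries $1$ and all off-diagonal entries $\rho$. The models are $M_0:\theta_1=\dots=\theta_n=0$ (null model) and, for $i=1,\dots,n$, $M_i:\theta_i\ne 0,\ \theta_k=0$ for all $k\neq i$. Saying that "$M_j$ is true" ($j\ge1$) means the data are generated with a fixed value $\theta_j\neq0$ and all other means zero; "$M_0$ is true" means $\boldsymbol\theta=0$. Bayesian procedure. Prior model probabilities are $P(M_0)=r$ and $P(M_i)=(1-r)/n$ for $i\ge1$. Under $M_i$ ($i\ge 1$) the prior on $\theta_i$ is $N(0,\tau^2)$. The marginal density $m_0$ of $\boldsymbol x$ under $M_0$ is that of $N(\boldsymbol 0,\Sigma_0)$, and the marginal density $m_i$ under $M_i$ is that of $N(\boldsymbol 0,\Sigma_i)$, where $\Sigma_i$ is $\Sigma_0$ with its $(i,i)$ entry replaced by $1+\tau^2$. The posterior probabilities are $P(M_i\mid\boldsymbol x)=m_i(\boldsymbol x)P(M_i)/\sum_{j=0}^n m_j(\boldsymbol x)P(M_j)$. *)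

theory Defs
  imports "HOL-Probability.Probability"
begin

text \<open>
  The coordinates are indexed by a finite type \<open>'n\<close> (so \<open>n = CARD('n)\<close>), and the models by
  \<open>'n option\<close>: \<open>None\<close> is the null model \<open>M\<^sub>0\<close> and \<open>Some i\<close> is \<open>M\<^sub>i\<close>.
\<close>

text \<open>Lebesgue density of \<open>N(\<mu>, S)\<close>; only meaningful for positive definite \<open>S\<close>.\<close>

definition mvn_density :: "real ^ 'n \<Rightarrow> real ^ 'n ^ 'n \<Rightarrow> real ^ 'n \<Rightarrow> real" where
  "mvn_density \<mu> S x =
     exp (- ((x - \<mu>) \<bullet> (matrix_inv S *v (x - \<mu>))) / 2) / sqrt ((2 * pi) ^ CARD('n) * det S)"

definition cov :: "real \<Rightarrow> real \<Rightarrow> 'n::finite option \<Rightarrow> real ^ 'n ^ 'n" where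
  "cov \<tau> \<rho> m =
     (\<chi> k l. if k \<noteq> l then \<rho> else if m = Some k then 1 + \<tau>\<^sup>2 else 1)"

definition model_true :: "'n::finite option \<Rightarrow> real ^ 'n \<Rightarrow> bool" where
  "model_true m \<theta> =
     (case m of None \<Rightarrow> \<theta> = 0 | Some i \<Rightarrow> \<theta> $ i \<noteq> 0 \<and> (\<forall>k. k \<noteq> i \<longrightarrow> \<theta> $ k = 0))"

definition prior :: "real \<Rightarrow> 'n::finite option \<Rightarrow> real" where
  "prior r m = (case m of None \<Rightarrow> r | Some i \<Rightarrow> (1 - r) / real CARD('n))"

text \<open>
  Integrating \<open>N(\<theta>\<^sub>i e\<^sub>i, \<Sigma>\<^sub>0)\<close> against the prior \<open>N(0, \<tau>\<^sup>2)\<close> on \<open>\<theta>\<^sub>i\<close> gives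
  \<open>N(0, \<Sigma>\<^sub>0 + \<tau>\<^sup>2 e\<^sub>i e\<^sub>i\<^sup>T)\<close>, which is the marginal under \<open>M\<^sub>i\<close>.
\<close>

definition marginal :: "real \<Rightarrow> real \<Rightarrow> 'n::finite option \<Rightarrow> real ^ 'n \<Rightarrow> real" where
  "marginal \<tau> \<rho> m x = mvn_density 0 (cov \<tau> \<rho> m) x"

definition posterior :: "real \<Rightarrow> real \<Rightarrow> real \<Rightarrow> real ^ 'n \<Rightarrow> 'n::finite option \<Rightarrow> real" where
  "posterior r \<tau> \<rho> x m =
     marginal \<tau> \<rho> m x * prior r m / (\<Sum>j\<in>UNIV. marginal \<tau> \<rho> j x * prior r j)"

text \<open>The observed vector, given the values \<open>z\<close> and \<open>w\<close> of the common and individual noise.\<close>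

definition obs :: "real ^ 'n \<Rightarrow> real \<Rightarrow> real \<Rightarrow> ('n::finite \<Rightarrow> real) \<Rightarrow> real ^ 'n" where
  "obs \<theta> \<rho> z w = (\<chi> i. \<theta> $ i + sqrt \<rho> * z + sqrt (1 - \<rho>) * w i)"

end

theory Submission
  imports Defs "HOL-Real_Asymp.Real_Asymp"
begin

text \<open>
  The convergence is pathwise: it holds for every value of the noise \<open>z\<close>, \<open>w\<close>, and the
  almost sure statement follows at once. The density of \<open>M\<^sub>0\<close> cancels in the posterior
  probabilities, so only the Bayes factors \<open>B\<^sub>i = m\<^sub>i / m\<^sub>0\<close> matter. The matrix \<open>\<Sigma>\<^sub>i\<close> is a rank-one
  perturbation of \<open>\<Sigma>\<^sub>0\<close>, hence, writing \<open>s = 1 - \<rho>\<close>, \<open>a = 1 + (n - 1) \<rho>\<close> and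
  \<open>g = s (\<Sigma>\<^sub>0\<^sup>-\<^sup>1)\<^sub>i\<^sub>i = (1 + (n - 2) \<rho>) / a\<close>, the formulas of Sherman and Morrison give
  \<open>B\<^sub>i = exp (\<tau>\<^sup>2 / (2 (s + \<tau>\<^sup>2 g)) * d\<^sub>i\<^sup>2 / s) / sqrt (1 + \<tau>\<^sup>2 g / s)\<close>, where
  \<open>d = s \<Sigma>\<^sub>0\<^sup>-\<^sup>1 x\<close> has the entries \<open>d\<^sub>i = x\<^sub>i - (\<rho> / a) \<Sum>x\<close>.

  As \<open>\<rho>\<close> tends to \<open>1\<close> the \<open>d\<^sub>i\<close> become deviations from the sample mean, in which the common
  noise \<open>z\<close> disappears and the individual noise has size \<open>sqrt s\<close>. This decides every case.

  \<^item> Under \<open>M\<^sub>0\<close>, the quotient \<open>d\<^sub>i\<^sup>2 / s\<close> converges, so the square root in the denominator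
    drives \<open>B\<^sub>i\<close> to \<open>0\<close> (\<open>bayes_factor_tendsto_0\<close>).

  \<^item> Under \<open>M\<^sub>j\<close>, with \<open>t = \<theta>\<^sub>j\<close>, the limits of the \<open>d\<^sub>i\<close> are \<open>t (1 - 1 / n)\<close> for \<open>i = j\<close> and
    \<open>- t / n\<close> otherwise. None of them is \<open>0\<close>, so every \<open>B\<^sub>i\<close> grows exponentially in \<open>1 / s\<close>
    and the null model loses to all others (\<open>inverse_bayes_factor_tendsto_0\<close>).

  \<^item> If \<open>n > 2\<close> then \<open>1 / n < 1 - 1 / n\<close>, so \<open>d\<^sub>j\<close> is largest in absolute value and \<open>B\<^sub>j\<close> has
    the largest exponential rate (\<open>bayes_factor_ratio_tendsto_0\<close>).

  \<^item> If \<open>n = 2\<close> both limits have the same absolute value. Then \<open>d\<^sub>1\<^sup>2 - d\<^sub>2\<^sup>2\<close> is itself of order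
    \<open>s\<close>, namely \<open>s (x\<^sub>1\<^sup>2 - x\<^sub>2\<^sup>2) / (1 + \<rho>)\<close>, and the ratio of the two Bayes factors has a finite
    nonzero limit (\<open>bayes_factor_ratio_pair\<close>).

  Limits of ratios of weights turn into limits of normalised weights by
  \<open>tendsto_normalized_weights\<close>.
\<close>

section \<open>Gaussian densities under a perturbation of one diagonal entry\<close>

text \<open>
  Quadratic forms in an inverse matrix are evaluated below by solving a linear system, so that
  the entries of the inverse never have to be computed.
\<close>

lemma matrix_inv_vec_eqI:
  fixes A :: "real ^ 'n ^ 'n"
  assumes "invertible A" "A *v y = x"
  shows "matrix_inv A *v x = y"
proof -
  have "matrix_inv A ** A = mat 1"
    using assms(1) unfolding invertible_def matrix_inv_def by (rule someI2_ex) blast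
  moreover have "matrix_inv A *v x = (matrix_inv A ** A) *v y"
    using assms(2) by (simp add: matrix_vector_mul_assoc [symmetric])
  ultimately show ?thesis
    by simp
qed

definition bump_diagonal :: "real ^ 'n ^ 'n \<Rightarrow> 'n \<Rightarrow> real \<Rightarrow> real ^ 'n ^ 'n" where
  "bump_diagonal A i t = (\<chi> k l. A $ k $ l + (if k = i \<and> l = i then t else 0))"

lemma bump_diagonal_mult_vec:
  fixes A :: "real ^ 'n ^ 'n"
  shows "bump_diagonal A i t *v v = A *v v + (t * v $ i) *\<^sub>R axis i 1"
proof -
  have "(\<Sum>l\<in>UNIV. (A $ k $ l + (if k = i \<and> l = i then t else 0)) * v $ l)
        = (\<Sum>l\<in>UNIV. A $ k $ l * v $ l) + (if k = i then t * v $ i else 0)" for k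
    by (cases "k = i")
      (simp_all add: distrib_right sum.distrib if_distrib [of "\<lambda>c. c * _"] sum.delta cong: if_cong)
  then show ?thesis
    by (auto simp: vec_eq_iff bump_diagonal_def matrix_vector_mult_def axis_def)
qed

text \<open>
  The row \<open>i\<close> of the perturbed matrix is a linear combination of the rows of \<open>A\<close>: symmetry turns
  \<open>A b = e\<^sub>i\<close> into the statement that \<open>e\<^sub>i\<close> is the combination with coefficients \<open>b\<close>. Cramer's
  rule then reads off the determinant as a coefficient times \<open>det A\<close>.
\<close>

lemma det_bump_diagonal:
  fixes A :: "real ^ 'n ^ 'n"
  assumes sym: "transpose A = A" and b: "A *v b = axis i 1"
  shows "det (bump_diagonal A i t) = (1 + t * b $ i) * det A"
proof -
  define c where "c = axis i 1 + t *\<^sub>R b"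
  have "(\<Sum>k\<in>UNIV. c $ k *s row k A) = transpose A *v c"
    by (simp add: matrix_mult_sum column_transpose)
  also have "\<dots> = A *v axis i 1 + t *\<^sub>R (A *v b)"
    unfolding c_def sym by (simp add: matrix_vector_right_distrib matrix_vector_mult_scaleR)
  also have "\<dots> = column i A + t *\<^sub>R axis i 1"
    by (simp add: b matrix_vector_mul_component matrix_vector_mult_basis)
  also have "column i A = row i A"
    by (metis sym column_transpose)
  finally have "(\<Sum>k\<in>UNIV. c $ k *s row k A) = row i A + t *\<^sub>R axis i 1" .
  then have "bump_diagonal A i t
      = (\<chi> k. if k = i then \<Sum>k\<in>UNIV. c $ k *s row k A else row k A)"
    by (auto simp: vec_eq_iff bump_diagonal_def row_def axis_def)
  then have "det (bump_diagonal A i t) = c $ i * det A"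
    by (simp only: cramer_lemma_transpose)
  then show ?thesis
    by (simp add: c_def axis_def)
qed

text \<open>
  The Sherman--Morrison formula, with \<open>A\<^sup>-\<^sup>1 e\<^sub>i\<close> and \<open>A\<^sup>-\<^sup>1 x\<close> given as the solutions \<open>b\<close> and \<open>y\<close> of
  linear systems: the quadratic form drops by \<open>t y\<^sub>i\<^sup>2 / (1 + t b\<^sub>i)\<close> and the determinant is
  multiplied by \<open>1 + t b\<^sub>i\<close>. The root of the determinant splits into factors of either sign, since
  the real square root is extended to negative numbers as an odd function.
\<close>

lemma mvn_density_bump_diagonal:
  fixes A :: "real ^ 'n ^ 'n"
  assumes inv: "invertible A" and sym: "transpose A = A"
    and b: "A *v b = axis i 1" and y: "A *v y = x" and nz: "1 + t * b $ i \<noteq> 0"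
  shows "mvn_density 0 (bump_diagonal A i t) x
         = mvn_density 0 A x * (exp (t * (y $ i)\<^sup>2 / (2 * (1 + t * b $ i))) / sqrt (1 + t * b $ i))"
proof -
  let ?C = "bump_diagonal A i t" and ?q = "1 + t * b $ i"
  \<comment> \<open>The candidate for \<open>?C\<^sup>-\<^sup>1 x\<close>: the component \<open>t v\<^sub>i e\<^sub>i\<close> that the perturbation adds to \<open>A v\<close>
    must cancel against a multiple of \<open>A b = e\<^sub>i\<close>.\<close>
  define v where "v = y - (t * y $ i / ?q) *\<^sub>R b"
  have detC: "det ?C = ?q * det A"
    by (rule det_bump_diagonal [OF sym b])
  then have invC: "invertible ?C"
    using inv nz by (simp add: invertible_det_nz)
  have vi: "v $ i = y $ i / ?q"
    using nz by (simp add: v_def field_simps)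
  have "?C *v v = A *v v + (t * v $ i) *\<^sub>R axis i 1"
    by (rule bump_diagonal_mult_vec)
  also have "A *v v = x - (t * y $ i / ?q) *\<^sub>R axis i 1"
    by (simp add: v_def matrix_vector_mult_diff_distrib matrix_vector_mult_scaleR b y)
  finally have Cv: "?C *v v = x"
    by (simp add: vi)
  have "x \<bullet> b = y \<bullet> (A *v b)"
    using y sym by (metis dot_lmul_matrix inner_commute transpose_matrix_vector)
  then have xb: "x \<bullet> b = y $ i"
    by (simp add: b inner_axis)
  have "x \<bullet> (matrix_inv ?C *v x) = x \<bullet> v"
    by (simp add: matrix_inv_vec_eqI [OF invC Cv])
  also have "\<dots> = x \<bullet> (matrix_inv A *v x) - t * (y $ i)\<^sup>2 / ?q"
    by (simp add: v_def matrix_inv_vec_eqI [OF inv y] inner_diff_right xb power2_eq_square)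
  finally have quad: "x \<bullet> (matrix_inv ?C *v x) = x \<bullet> (matrix_inv A *v x) - t * (y $ i)\<^sup>2 / ?q" .
  have "exp (- (x \<bullet> (matrix_inv ?C *v x)) / 2)
      = exp (- (x \<bullet> (matrix_inv A *v x)) / 2) * exp (t * (y $ i)\<^sup>2 / (2 * ?q))"
    unfolding quad exp_add [symmetric] by (rule arg_cong [of _ _ exp]) (use nz in \<open>simp add: field_simps\<close>)
  then show ?thesis
    by (simp add: mvn_density_def detC real_sqrt_mult)
qed

section \<open>The Bayes factors\<close>

text \<open>
  The vector \<open>(1 - \<rho>) \<Sigma>\<^sub>0\<^sup>-\<^sup>1 x\<close>. The factor \<open>1 - \<rho>\<close> keeps it bounded as \<open>\<rho>\<close> tends to \<open>1\<close>, where it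
  becomes the vector of deviations from the sample mean.
\<close>

definition shrunk_dev :: "real \<Rightarrow> real ^ 'n::finite \<Rightarrow> 'n \<Rightarrow> real" where
  "shrunk_dev \<rho> x i = x $ i - \<rho> / (1 + (real CARD('n) - 1) * \<rho>) * (\<Sum>k\<in>UNIV. x $ k)"

text \<open>
  The number \<open>(1 - \<rho>) (\<Sigma>\<^sub>0\<^sup>-\<^sup>1)\<^sub>i\<^sub>i\<close>, the same for all \<open>i\<close>.
\<close>

definition scaled_precision :: "real \<Rightarrow> real \<Rightarrow> real" where
  "scaled_precision n \<rho> = (1 + (n - 2) * \<rho>) / (1 + (n - 1) * \<rho>)"

text \<open>
  The closed form of \<open>m\<^sub>i(x) / m\<^sub>0(x)\<close>, arranged so that the divergence as \<open>\<rho>\<close> tends to \<open>1\<close> is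
  visible: the coefficient in front of \<open>d\<^sub>i\<^sup>2 / (1 - \<rho>)\<close> has a positive limit.
\<close>

definition bayes_factor :: "real \<Rightarrow> real \<Rightarrow> real ^ 'n::finite \<Rightarrow> 'n option \<Rightarrow> real" where
  "bayes_factor \<tau> \<rho> x m = (case m of None \<Rightarrow> 1 | Some i \<Rightarrow>
     exp (\<tau>\<^sup>2 / (2 * (1 - \<rho> + \<tau>\<^sup>2 * scaled_precision (real CARD('n)) \<rho>)) * ((shrunk_dev \<rho> x i)\<^sup>2 / (1 - \<rho>)))
       / sqrt (1 + \<tau>\<^sup>2 * scaled_precision (real CARD('n)) \<rho> / (1 - \<rho>)))"

lemma equicorrelation_denom_pos:
  fixes n \<rho> :: real
  assumes "1 \<le> n" "0 < \<rho>"
  shows "0 < 1 + (n - 1) * \<rho>"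
  using assms by (simp add: add_pos_nonneg)

lemma card_type_ge_1: "1 \<le> real CARD('n::finite)"
  by (simp add: Suc_leI)

text \<open>
  Since \<open>\<Sigma>\<^sub>0 = (1 - \<rho>) I + \<rho> J\<close> with the all-ones matrix \<open>J\<close>, only the total of the solution has to
  be known, and the deviations add up to \<open>(1 - \<rho>) / a\<close> times the total of \<open>x\<close>.
\<close>

lemma cov_None_solve:
  fixes x :: "real ^ 'n::finite"
  assumes "0 < \<rho>" "\<rho> < 1"
  shows "cov \<tau> \<rho> None *v (\<chi> k. shrunk_dev \<rho> x k / (1 - \<rho>)) = x"
proof -
  let ?a = "1 + (real CARD('n) - 1) * \<rho>" and ?S = "\<Sum>k\<in>UNIV. x $ k"
  have a: "?a > 0"
    by (rule equicorrelation_denom_pos [OF card_type_ge_1 assms(1)])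
  have tot: "(\<Sum>k\<in>UNIV. shrunk_dev \<rho> x k) = (1 - \<rho>) * ?S / ?a"
  proof -
    have "(\<Sum>k\<in>UNIV. shrunk_dev \<rho> x k) = ?S - real CARD('n) * (\<rho> / ?a * ?S)"
      by (simp add: shrunk_dev_def sum_subtractf)
    also have "\<dots> = (1 - \<rho>) * ?S / ?a"
      using a by (simp add: divide_simps) (simp add: algebra_simps)
    finally show ?thesis .
  qed
  have "(\<Sum>l\<in>UNIV. (if k \<noteq> l then \<rho> else 1) * (shrunk_dev \<rho> x l / (1 - \<rho>))) = x $ k" for k
  proof -
    have "(\<Sum>l\<in>UNIV. (if k \<noteq> l then \<rho> else 1) * (shrunk_dev \<rho> x l / (1 - \<rho>)))
        = (\<Sum>l\<in>UNIV. \<rho> / (1 - \<rho>) * shrunk_dev \<rho> x l + (if k = l then shrunk_dev \<rho> x l else 0))"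
      by (rule sum.cong) (use assms in \<open>auto simp: field_simps\<close>)
    also have "\<dots> = \<rho> / (1 - \<rho>) * (\<Sum>l\<in>UNIV. shrunk_dev \<rho> x l) + shrunk_dev \<rho> x k"
      by (simp add: sum.distrib sum_distrib_left)
    also have "\<dots> = x $ k"
      using assms by (simp add: tot) (simp add: shrunk_dev_def)
    finally show ?thesis .
  qed
  then show ?thesis
    by (simp add: vec_eq_iff cov_def matrix_vector_mult_def cong: if_cong)
qed

lemma invertible_cov_None:
  assumes "0 < \<rho>" "\<rho> < 1"
  shows "invertible (cov \<tau> \<rho> None :: real ^ 'n ^ 'n::finite)"
proof -
  have "surj ((*v) (cov \<tau> \<rho> None :: real ^ 'n ^ 'n))"
    by (rule surjI [where f = "\<lambda>x. \<chi> k. shrunk_dev \<rho> x k / (1 - \<rho>)"]) (rule cov_None_solve [OF assms])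
  then show ?thesis
    using matrix_right_invertible_surjective invertible_right_inverse by blast
qed

lemma scaled_precision_bounds:
  assumes "1 < n" "0 < \<rho>" "\<rho> < 1"
  shows "0 < scaled_precision n \<rho>" "scaled_precision n \<rho> \<le> 1"
proof -
  \<comment> \<open>The numerator \<open>1 + (n - 2) \<rho>\<close>, written with positive terms also when \<open>n < 2\<close>.\<close>
  have "0 < (1 - \<rho>) + (n - 1) * \<rho>"
    using assms by (intro add_pos_pos mult_pos_pos) auto
  then have "0 < 1 + (n - 2) * \<rho>" by (simp add: algebra_simps)
  moreover have "0 < 1 + (n - 1) * \<rho>"
    using assms by (intro equicorrelation_denom_pos) auto
  ultimately show "0 < scaled_precision n \<rho>" "scaled_precision n \<rho> \<le> 1"
    using assms by (simp_all add: scaled_precision_def divide_simps algebra_simps)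
qed

lemma marginal_eq_bayes_factor:
  fixes x :: "real ^ 'n::finite"
  assumes n: "2 \<le> CARD('n)" and \<rho>: "0 < \<rho>" "\<rho> < 1"
  shows "marginal \<tau> \<rho> m x = marginal \<tau> \<rho> None x * bayes_factor \<tau> \<rho> x m"
proof (cases m)
  case None
  then show ?thesis by (simp add: bayes_factor_def)
next
  case (Some i)
  let ?A = "cov \<tau> \<rho> None :: real ^ 'n ^ 'n" and ?g = "scaled_precision (real CARD('n)) \<rho>"
  define b :: "real ^ 'n" where "b = (\<chi> k. shrunk_dev \<rho> (axis i 1) k / (1 - \<rho>))"
  define y where "y = (\<chi> k. shrunk_dev \<rho> x k / (1 - \<rho>))"
  have g: "?g > 0"
    by (rule scaled_precision_bounds) (use assms in auto)
  have a: "1 + (real CARD('n) - 1) * \<rho> > 0"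
    by (rule equicorrelation_denom_pos [OF card_type_ge_1 \<rho>(1)])
  have bi: "b $ i = ?g / (1 - \<rho>)"
    using a by (simp add: b_def shrunk_dev_def axis_def scaled_precision_def divide_simps) (simp add: algebra_simps)
  have pos: "0 < 1 - \<rho> + \<tau>\<^sup>2 * ?g"
    using g \<rho> by (simp add: add_pos_nonneg)
  have q: "1 + \<tau>\<^sup>2 * b $ i = (1 - \<rho> + \<tau>\<^sup>2 * ?g) / (1 - \<rho>)"
    using \<rho> by (simp add: bi field_simps)
  have C: "cov \<tau> \<rho> (Some i) = bump_diagonal ?A i (\<tau>\<^sup>2)"
    by (auto simp: vec_eq_iff cov_def bump_diagonal_def)
  have "mvn_density 0 (bump_diagonal ?A i (\<tau>\<^sup>2)) x
      = mvn_density 0 ?A x * (exp (\<tau>\<^sup>2 * (y $ i)\<^sup>2 / (2 * (1 + \<tau>\<^sup>2 * b $ i))) / sqrt (1 + \<tau>\<^sup>2 * b $ i))"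
  proof (rule mvn_density_bump_diagonal)
    show "invertible ?A" by (rule invertible_cov_None [OF \<rho>])
    show "transpose ?A = ?A" by (auto simp: vec_eq_iff transpose_def cov_def)
    show "?A *v b = axis i 1" unfolding b_def by (rule cov_None_solve [OF \<rho>])
    show "?A *v y = x" unfolding y_def by (rule cov_None_solve [OF \<rho>])
    show "1 + \<tau>\<^sup>2 * b $ i \<noteq> 0" unfolding q using pos \<rho> by simp
  qed
  moreover have "\<tau>\<^sup>2 * (y $ i)\<^sup>2 / (2 * (1 + \<tau>\<^sup>2 * b $ i))
      = \<tau>\<^sup>2 / (2 * (1 - \<rho> + \<tau>\<^sup>2 * ?g)) * ((shrunk_dev \<rho> x i)\<^sup>2 / (1 - \<rho>))"
    unfolding q using pos \<rho> by (simp add: y_def power_divide power2_eq_square)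
  ultimately show ?thesis
    by (simp add: Some marginal_def C bayes_factor_def bi)
qed

lemma variance_inflation_pos:
  assumes "1 < n" "0 < \<rho>" "\<rho> < 1"
  shows "0 < 1 + \<tau>\<^sup>2 * scaled_precision n \<rho> / (1 - \<rho>)"
  using scaled_precision_bounds(1) [OF assms] assms
  by (intro add_pos_nonneg divide_nonneg_nonneg mult_nonneg_nonneg) auto

lemma bayes_factor_pos:
  fixes x :: "real ^ 'n::finite"
  assumes n: "2 \<le> CARD('n)" and \<rho>: "0 < \<rho>" "\<rho> < 1"
  shows "0 < bayes_factor \<tau> \<rho> x m"
  using variance_inflation_pos [of "real CARD('n)" \<rho> \<tau>] assms
  by (auto simp: bayes_factor_def split: option.split)

text \<open>
  Invertibility of \<open>\<Sigma>\<^sub>0\<close> makes the null density nonzero, so it may be cancelled.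
\<close>

lemma posterior_eq_bayes_factor:
  fixes x :: "real ^ 'n::finite"
  assumes n: "2 \<le> CARD('n)" and \<rho>: "0 < \<rho>" "\<rho> < 1"
  shows "posterior r \<tau> \<rho> x m
    = bayes_factor \<tau> \<rho> x m * prior r m / (\<Sum>j\<in>UNIV. bayes_factor \<tau> \<rho> x j * prior r j)"
proof -
  have "marginal \<tau> \<rho> None x \<noteq> 0"
    using invertible_cov_None [OF \<rho>, of \<tau>, where ?'n = 'n]
    by (simp add: marginal_def mvn_density_def invertible_det_nz)
  then show ?thesis
    unfolding posterior_def
    by (subst (1 2) marginal_eq_bayes_factor [OF assms])
      (simp add: mult.assoc sum_distrib_left [symmetric])
qed

section \<open>Limits of the Bayes factors\<close>

lemma eventually_at_left_1:
  "\<forall>\<^sub>F \<rho>::real in at_left 1. 0 < \<rho> \<and> \<rho> < 1"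
  by (rule eventually_at_leftI [of 0]) auto

text \<open>
  Dividing by one reference weight makes all terms convergent, even when the weights themselves
  tend to infinity.
\<close>

lemma tendsto_normalized_weights:
  fixes v :: "'m::finite \<Rightarrow> 'b \<Rightarrow> real"
  assumes lim: "\<And>m. ((\<lambda>x. v m x / v j x) \<longlongrightarrow> l m) F"
    and nz: "\<forall>\<^sub>F x in F. v j x \<noteq> 0" and l: "(\<Sum>m\<in>UNIV. l m) \<noteq> 0"
  shows "((\<lambda>x. v i x / (\<Sum>m\<in>UNIV. v m x)) \<longlongrightarrow> l i / (\<Sum>m\<in>UNIV. l m)) F"
proof (rule Lim_transform_eventually)
  show "((\<lambda>x. (v i x / v j x) / (\<Sum>m\<in>UNIV. v m x / v j x)) \<longlongrightarrow> l i / (\<Sum>m\<in>UNIV. l m)) F"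
    by (intro tendsto_intros lim l)
  show "\<forall>\<^sub>F x in F. (v i x / v j x) / (\<Sum>m\<in>UNIV. v m x / v j x) = v i x / (\<Sum>m\<in>UNIV. v m x)"
    using nz by eventually_elim (simp add: sum_divide_distrib [symmetric])
qed

lemma tendsto_scaled_precision:
  assumes "1 < n"
  shows "((\<lambda>\<rho>. scaled_precision n \<rho>) \<longlongrightarrow> (n - 1) / n) (at_left 1)"
proof -
  have "((\<lambda>\<rho>. scaled_precision n \<rho>) \<longlongrightarrow> (1 + (n - 2) * 1) / (1 + (n - 1) * 1)) (at_left 1)"
    unfolding scaled_precision_def by (intro tendsto_intros) (use assms in auto)
  then show ?thesis by simp
qed

lemma tendsto_evidence_scale:
  assumes "1 < n" "\<tau>\<^sup>2 > 0"
  shows "((\<lambda>\<rho>. \<tau>\<^sup>2 / (2 * (1 - \<rho> + \<tau>\<^sup>2 * scaled_precision n \<rho>))) \<longlongrightarrow> n / (2 * (n - 1))) (at_left (1::real))"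
proof -
  have "((\<lambda>\<rho>. \<tau>\<^sup>2 / (2 * (1 - \<rho> + \<tau>\<^sup>2 * scaled_precision n \<rho>)))
      \<longlongrightarrow> \<tau>\<^sup>2 / (2 * (1 - 1 + \<tau>\<^sup>2 * ((n - 1) / n)))) (at_left 1)"
    by (intro tendsto_intros tendsto_scaled_precision) (use assms in auto)
  moreover have "\<tau>\<^sup>2 / (2 * (1 - 1 + \<tau>\<^sup>2 * ((n - 1) / n))) = n / (2 * (n - 1))"
    using assms by (simp add: field_simps)
  ultimately show ?thesis by simp
qed

text \<open>
  A nonzero limiting deviation counts against the null model at the exponential rate
  \<open>1 / (1 - \<rho>)\<close>, whereas the square root in the Bayes factor grows only polynomially in
  \<open>1 / (1 - \<rho>)\<close>.
\<close>

lemma inverse_bayes_factor_tendsto_0: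
  fixes x :: "real \<Rightarrow> real ^ 'n::finite"
  assumes n: "2 \<le> CARD('n)" and \<tau>: "\<tau>\<^sup>2 > 0"
    and d: "((\<lambda>\<rho>. shrunk_dev \<rho> (x \<rho>) i) \<longlongrightarrow> \<delta>) (at_left 1)" and \<delta>: "\<delta> \<noteq> 0"
  shows "((\<lambda>\<rho>. inverse (bayes_factor \<tau> \<rho> (x \<rho>) (Some i))) \<longlongrightarrow> 0) (at_left 1)"
proof -
  let ?n = "real CARD('n)"
  define h where "h \<rho> = \<tau>\<^sup>2 / (2 * (1 - \<rho> + \<tau>\<^sup>2 * scaled_precision ?n \<rho>))" for \<rho>
  \<comment> \<open>Half the limit of \<open>h \<rho>\<close> times the squared deviation, hence eventually a lower bound for it.\<close>
  define c where "c = ?n / (2 * (?n - 1)) * \<delta>\<^sup>2 / 2"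
  have n1: "1 < ?n" using n by simp
  have c: "c > 0" using n1 \<delta> by (simp add: c_def)
  have c2: "?n / (2 * (?n - 1)) * \<delta>\<^sup>2 = 2 * c"
    unfolding c_def by (simp only: times_divide_eq_right nonzero_mult_div_cancel_left)
  have "((\<lambda>\<rho>. h \<rho> * (shrunk_dev \<rho> (x \<rho>) i)\<^sup>2) \<longlongrightarrow> ?n / (2 * (?n - 1)) * \<delta>\<^sup>2) (at_left 1)"
    unfolding h_def by (intro tendsto_intros tendsto_evidence_scale d n1 \<tau>)
  moreover have "c < ?n / (2 * (?n - 1)) * \<delta>\<^sup>2"
    using c unfolding c2 by simp
  ultimately have ev: "\<forall>\<^sub>F \<rho> in at_left 1. c < h \<rho> * (shrunk_dev \<rho> (x \<rho>) i)\<^sup>2"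
    by (rule order_tendstoD(1))
  have main: "((\<lambda>\<rho>::real. (1 + \<tau>\<^sup>2 / (1 - \<rho>)) * exp (- (c / (1 - \<rho>)))) \<longlongrightarrow> 0) (at_left 1)"
    using c \<tau> by real_asymp
  show ?thesis
  proof (rule tendsto_sandwich [OF _ _ tendsto_const main])
    show "\<forall>\<^sub>F \<rho> in at_left 1. 0 \<le> inverse (bayes_factor \<tau> \<rho> (x \<rho>) (Some i))"
      using eventually_at_left_1
    proof eventually_elim
      case (elim \<rho>)
      then show ?case
        using bayes_factor_pos [OF n, of \<rho> \<tau> "x \<rho>" "Some i"] by simp
    qed
    show "\<forall>\<^sub>F \<rho> in at_left 1. inverse (bayes_factor \<tau> \<rho> (x \<rho>) (Some i))
        \<le> (1 + \<tau>\<^sup>2 / (1 - \<rho>)) * exp (- (c / (1 - \<rho>)))"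
      using eventually_at_left_1 ev
    proof eventually_elim
      case (elim \<rho>)
      note g = scaled_precision_bounds [OF n1, of \<rho>]
      let ?u = "\<tau>\<^sup>2 * scaled_precision ?n \<rho> / (1 - \<rho>)"
      have u: "0 \<le> ?u" "?u \<le> \<tau>\<^sup>2 / (1 - \<rho>)"
        using g elim \<tau> by (simp_all add: divide_right_mono mult_left_le)
      have "sqrt (1 + t) \<le> 1 + t" if "0 \<le> t" for t :: real
        using that by (intro real_le_lsqrt) (auto simp: power2_eq_square algebra_simps)
      from this [OF u(1)] have A: "sqrt (1 + ?u) \<le> 1 + \<tau>\<^sup>2 / (1 - \<rho>)"
        using u(2) by linarith
      have "c / (1 - \<rho>) \<le> h \<rho> * (shrunk_dev \<rho> (x \<rho>) i)\<^sup>2 / (1 - \<rho>)"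
        using elim by (intro divide_right_mono) simp_all
      then have B: "exp (- (h \<rho> * ((shrunk_dev \<rho> (x \<rho>) i)\<^sup>2 / (1 - \<rho>)))) \<le> exp (- (c / (1 - \<rho>)))"
        unfolding exp_le_cancel_iff neg_le_iff_le times_divide_eq_right .
      have "inverse (bayes_factor \<tau> \<rho> (x \<rho>) (Some i))
          = sqrt (1 + ?u) * exp (- (h \<rho> * ((shrunk_dev \<rho> (x \<rho>) i)\<^sup>2 / (1 - \<rho>))))"
        unfolding bayes_factor_def option.case h_def [symmetric] inverse_divide exp_minus
        by (rule divide_inverse)
      also have "\<dots> \<le> (1 + \<tau>\<^sup>2 / (1 - \<rho>)) * exp (- (c / (1 - \<rho>)))"
        using A B u elim by (intro mult_mono) auto
      finally show ?case .
    qed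
  qed
qed

text \<open>
  When the deviation is of the size of the individual noise, the exponential stays bounded and the
  growing variance of \<open>M\<^sub>i\<close> alone decides in favour of the null model.
\<close>

lemma bayes_factor_tendsto_0:
  fixes x :: "real \<Rightarrow> real ^ 'n::finite"
  assumes n: "2 \<le> CARD('n)" and \<tau>: "\<tau>\<^sup>2 > 0"
    and d: "((\<lambda>\<rho>. shrunk_dev \<rho> (x \<rho>) i / sqrt (1 - \<rho>)) \<longlongrightarrow> \<nu>) (at_left 1)"
  shows "((\<lambda>\<rho>. bayes_factor \<tau> \<rho> (x \<rho>) (Some i)) \<longlongrightarrow> 0) (at_left 1)"
proof -
  let ?n = "real CARD('n)"
  have n1: "1 < ?n" using n by simp
  have T: "LIM \<rho> at_left 1. sqrt (1 + \<tau>\<^sup>2 * scaled_precision ?n \<rho> / (1 - \<rho>)) :> at_top"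
  proof (rule filterlim_compose [OF sqrt_at_top], rule filterlim_tendsto_add_at_top [OF tendsto_const])
    have inv: "LIM \<rho> at_left (1::real). inverse (1 - \<rho>) :> at_top"
      by real_asymp
    have "((\<lambda>\<rho>. \<tau>\<^sup>2 * scaled_precision ?n \<rho>) \<longlongrightarrow> \<tau>\<^sup>2 * ((?n - 1) / ?n)) (at_left 1)"
      by (intro tendsto_intros tendsto_scaled_precision n1)
    from filterlim_tendsto_pos_mult_at_top [OF this _ inv]
    show "LIM \<rho> at_left 1. \<tau>\<^sup>2 * scaled_precision ?n \<rho> / (1 - \<rho>) :> at_top"
      using n1 \<tau> by (simp add: divide_inverse)
  qed
  have "((\<lambda>\<rho>. exp (\<tau>\<^sup>2 / (2 * (1 - \<rho> + \<tau>\<^sup>2 * scaled_precision ?n \<rho>)) * (shrunk_dev \<rho> (x \<rho>) i / sqrt (1 - \<rho>))\<^sup>2))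
      \<longlongrightarrow> exp (?n / (2 * (?n - 1)) * \<nu>\<^sup>2)) (at_left 1)"
    by (intro tendsto_intros tendsto_evidence_scale d n1 \<tau>)
  from tendsto_divide_0 [OF this filterlim_at_top_imp_at_infinity [OF T]]
  show ?thesis
    by (rule Lim_transform_eventually)
      (use eventually_at_left_1 in eventually_elim, simp add: bayes_factor_def power_divide)
qed

text \<open>
  All alternatives share the same variance term, so it cancels between two of them.
\<close>

lemma bayes_factor_ratio:
  fixes x :: "real ^ 'n::finite"
  assumes n: "2 \<le> CARD('n)" and \<rho>: "0 < \<rho>" "\<rho> < 1"
  shows "bayes_factor \<tau> \<rho> x (Some k) / bayes_factor \<tau> \<rho> x (Some i)
    = exp (\<tau>\<^sup>2 / (2 * (1 - \<rho> + \<tau>\<^sup>2 * scaled_precision (real CARD('n)) \<rho>))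
        * (((shrunk_dev \<rho> x k)\<^sup>2 - (shrunk_dev \<rho> x i)\<^sup>2) / (1 - \<rho>)))"
  using variance_inflation_pos [of "real CARD('n)" \<rho> \<tau>] assms
  by (simp add: bayes_factor_def exp_diff [symmetric] diff_divide_distrib right_diff_distrib)

lemma bayes_factor_ratio_tendsto_0:
  fixes x :: "real \<Rightarrow> real ^ 'n::finite"
  assumes n: "2 \<le> CARD('n)" and \<tau>: "\<tau>\<^sup>2 > 0"
    and dk: "((\<lambda>\<rho>. shrunk_dev \<rho> (x \<rho>) k) \<longlongrightarrow> \<delta>k) (at_left 1)"
    and di: "((\<lambda>\<rho>. shrunk_dev \<rho> (x \<rho>) i) \<longlongrightarrow> \<delta>i) (at_left 1)"
    and less: "\<delta>k\<^sup>2 < \<delta>i\<^sup>2"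
  shows "((\<lambda>\<rho>. bayes_factor \<tau> \<rho> (x \<rho>) (Some k) / bayes_factor \<tau> \<rho> (x \<rho>) (Some i)) \<longlongrightarrow> 0) (at_left 1)"
proof -
  let ?n = "real CARD('n)"
  let ?h = "\<lambda>\<rho>. \<tau>\<^sup>2 / (2 * (1 - \<rho> + \<tau>\<^sup>2 * scaled_precision ?n \<rho>))"
  let ?D = "\<lambda>\<rho>. (shrunk_dev \<rho> (x \<rho>) k)\<^sup>2 - (shrunk_dev \<rho> (x \<rho>) i)\<^sup>2"
  have n1: "1 < ?n" using n by simp
  have inv: "LIM \<rho> at_left (1::real). inverse (1 - \<rho>) :> at_top"
    by real_asymp
  have "((\<lambda>\<rho>. ?h \<rho> * ?D \<rho>) \<longlongrightarrow> ?n / (2 * (?n - 1)) * (\<delta>k\<^sup>2 - \<delta>i\<^sup>2)) (at_left 1)"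
    by (intro tendsto_intros tendsto_evidence_scale dk di n1 \<tau>)
  moreover have "?n / (2 * (?n - 1)) * (\<delta>k\<^sup>2 - \<delta>i\<^sup>2) < 0"
    using n1 less by (intro mult_pos_neg) auto
  ultimately have "LIM \<rho> at_left 1. (?h \<rho> * ?D \<rho>) * inverse (1 - \<rho>) :> at_bot"
    by (rule filterlim_tendsto_neg_mult_at_bot [OF _ _ inv])
  from filterlim_compose [OF exp_at_bot this]
  show ?thesis
  proof (rule Lim_transform_eventually)
    show "\<forall>\<^sub>F \<rho> in at_left 1. exp (?h \<rho> * ?D \<rho> * inverse (1 - \<rho>))
        = bayes_factor \<tau> \<rho> (x \<rho>) (Some k) / bayes_factor \<tau> \<rho> (x \<rho>) (Some i)"
      using eventually_at_left_1
      by eventually_elim (simp only: bayes_factor_ratio [OF n] divide_inverse [of _ "1 - _"] mult.assoc)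
  qed
qed

text \<open>
  Factor the difference of squares: the difference of the deviations is \<open>x\<^sub>k - x\<^sub>i\<close>, and for two
  coordinates their sum is \<open>x\<^sub>k + x\<^sub>i\<close> times \<open>1 - 2 \<rho> / (1 + \<rho>)\<close>, which vanishes to first order at
  \<open>\<rho> = 1\<close>. This factor compensates the division by \<open>1 - \<rho>\<close> in the exponents of the Bayes factors.
\<close>

lemma shrunk_dev_square_diff_pair:
  fixes x :: "real ^ 'n::finite"
  assumes n: "CARD('n) = 2" and \<rho>: "0 < \<rho>" and ki: "k \<noteq> i"
  shows "(shrunk_dev \<rho> x k)\<^sup>2 - (shrunk_dev \<rho> x i)\<^sup>2
    = (1 - \<rho>) / (1 + \<rho>) * ((x $ k)\<^sup>2 - (x $ i)\<^sup>2)"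
proof -
  have "{k, i} = (UNIV :: 'n set)"
    by (rule card_subset_eq) (use n ki in auto)
  then have S: "(\<Sum>l\<in>UNIV. x $ l) = x $ k + x $ i"
    using ki by (metis sum.insert finite.intros sum.empty add_0_right empty_iff insert_iff)
  have "(shrunk_dev \<rho> x k)\<^sup>2 - (shrunk_dev \<rho> x i)\<^sup>2
      = (x $ k - x $ i) * ((x $ k + x $ i) * (1 - 2 * (\<rho> / (1 + \<rho>))))"
  proof -
    have "(a - c * (a + b))\<^sup>2 - (b - c * (a + b))\<^sup>2 = (a - b) * ((a + b) * (1 - 2 * c))" for a b c :: real
      by (simp add: power2_eq_square algebra_simps)
    then show ?thesis
      unfolding shrunk_dev_def S n by (simp del: times_divide_eq_left times_divide_eq_right)
  qed
  also have "1 - 2 * (\<rho> / (1 + \<rho>)) = (1 - \<rho>) / (1 + \<rho>)"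
    using \<rho> by (simp add: field_simps)
  also have "(x $ k - x $ i) * ((x $ k + x $ i) * c) = c * ((x $ k)\<^sup>2 - (x $ i)\<^sup>2)" for c
    by (simp add: power2_eq_square algebra_simps)
  finally show ?thesis .
qed

text \<open>
  The coefficient \<open>1 / 2\<close> is the limit \<open>n / (2 (n - 1)) = 1\<close> of the evidence scale for \<open>n = 2\<close>, divided
  by the limit \<open>2\<close> of \<open>1 + \<rho>\<close>.
\<close>

lemma bayes_factor_ratio_pair:
  fixes x :: "real \<Rightarrow> real ^ 'n::finite"
  assumes n: "CARD('n) = 2" and \<tau>: "\<tau>\<^sup>2 > 0" and ki: "k \<noteq> i"
    and xk: "((\<lambda>\<rho>. x \<rho> $ k) \<longlongrightarrow> \<xi>k) (at_left 1)" and xi: "((\<lambda>\<rho>. x \<rho> $ i) \<longlongrightarrow> \<xi>i) (at_left 1)"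
  shows "((\<lambda>\<rho>. bayes_factor \<tau> \<rho> (x \<rho>) (Some k) / bayes_factor \<tau> \<rho> (x \<rho>) (Some i))
           \<longlongrightarrow> exp ((\<xi>k\<^sup>2 - \<xi>i\<^sup>2) / 2)) (at_left 1)"
proof -
  let ?h = "\<lambda>\<rho>. \<tau>\<^sup>2 / (2 * (1 - \<rho> + \<tau>\<^sup>2 * scaled_precision 2 \<rho>))"
  have "((\<lambda>\<rho>. exp (?h \<rho> / (1 + \<rho>) * ((x \<rho> $ k)\<^sup>2 - (x \<rho> $ i)\<^sup>2)))
      \<longlongrightarrow> exp (2 / (2 * (2 - 1)) / (1 + 1) * (\<xi>k\<^sup>2 - \<xi>i\<^sup>2))) (at_left 1)"
    by (intro tendsto_intros tendsto_evidence_scale xk xi \<tau>) auto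
  then have "((\<lambda>\<rho>. exp (?h \<rho> / (1 + \<rho>) * ((x \<rho> $ k)\<^sup>2 - (x \<rho> $ i)\<^sup>2)))
      \<longlongrightarrow> exp ((\<xi>k\<^sup>2 - \<xi>i\<^sup>2) / 2)) (at_left 1)"
    by simp
  then show ?thesis
  proof (rule Lim_transform_eventually)
    show "\<forall>\<^sub>F \<rho> in at_left 1. exp (?h \<rho> / (1 + \<rho>) * ((x \<rho> $ k)\<^sup>2 - (x \<rho> $ i)\<^sup>2))
        = bayes_factor \<tau> \<rho> (x \<rho>) (Some k) / bayes_factor \<tau> \<rho> (x \<rho>) (Some i)"
      using eventually_at_left_1
    proof eventually_elim
      case (elim \<rho>)
      have "((shrunk_dev \<rho> (x \<rho>) k)\<^sup>2 - (shrunk_dev \<rho> (x \<rho>) i)\<^sup>2) / (1 - \<rho>)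
          = ((x \<rho> $ k)\<^sup>2 - (x \<rho> $ i)\<^sup>2) / (1 + \<rho>)"
        using elim by (simp add: shrunk_dev_square_diff_pair [OF n _ ki])
      then show ?case
        using elim n by (simp add: bayes_factor_ratio)
    qed
  qed
qed

section \<open>The observations\<close>

lemma tendsto_obs:
  fixes \<theta> :: "real ^ 'n::finite"
  shows "((\<lambda>\<rho>. obs \<theta> \<rho> z w $ i) \<longlongrightarrow> \<theta> $ i + z) (at_left 1)"
proof -
  have "((\<lambda>\<rho>. \<theta> $ i + sqrt \<rho> * z + sqrt (1 - \<rho>) * w i)
      \<longlongrightarrow> \<theta> $ i + sqrt 1 * z + sqrt (1 - 1) * w i) (at_left 1)"
    by (intro tendsto_intros)
  then show ?thesis by (simp add: obs_def)
qed

text \<open>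
  The common noise shifts all coordinates equally and is removed by centring.
\<close>

lemma tendsto_shrunk_dev_obs:
  fixes \<theta> :: "real ^ 'n::finite"
  shows "((\<lambda>\<rho>. shrunk_dev \<rho> (obs \<theta> \<rho> z w) i)
           \<longlongrightarrow> \<theta> $ i - (\<Sum>k\<in>UNIV. \<theta> $ k) / real CARD('n)) (at_left 1)"
proof -
  have "((\<lambda>\<rho>. shrunk_dev \<rho> (obs \<theta> \<rho> z w) i)
      \<longlongrightarrow> (\<theta> $ i + z) - 1 / (1 + (real CARD('n) - 1) * 1) * (\<Sum>k\<in>UNIV. \<theta> $ k + z)) (at_left 1)"
    unfolding shrunk_dev_def by (intro tendsto_intros tendsto_obs) auto
  then show ?thesis by (simp add: sum.distrib field_simps)
qed

text \<open>
  At finite \<open>\<rho>\<close> the centring is imperfect and leaves the common noise with the factor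
  \<open>1 - n \<rho> / a = (1 - \<rho>) / a\<close>. This is of smaller order than \<open>sqrt (1 - \<rho>)\<close>, the size of the
  individual noise, which alone survives in the limit.
\<close>

lemma tendsto_shrunk_dev_null:
  fixes w :: "'n::finite \<Rightarrow> real"
  shows "((\<lambda>\<rho>. shrunk_dev \<rho> (obs 0 \<rho> z w) i / sqrt (1 - \<rho>))
           \<longlongrightarrow> w i - (\<Sum>k\<in>UNIV. w k) / real CARD('n)) (at_left 1)"
proof -
  let ?n = "real CARD('n)" and ?W = "\<Sum>k\<in>UNIV. w k"
  have "((\<lambda>\<rho>. sqrt \<rho> * z * (sqrt (1 - \<rho>) / (1 + (?n - 1) * \<rho>)) + (w i - \<rho> / (1 + (?n - 1) * \<rho>) * ?W))
      \<longlongrightarrow> sqrt 1 * z * (sqrt (1 - 1) / (1 + (?n - 1) * 1)) + (w i - 1 / (1 + (?n - 1) * 1) * ?W))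
      (at_left 1)"
    by (intro tendsto_intros) auto
  then have "((\<lambda>\<rho>. sqrt \<rho> * z * (sqrt (1 - \<rho>) / (1 + (?n - 1) * \<rho>)) + (w i - \<rho> / (1 + (?n - 1) * \<rho>) * ?W))
      \<longlongrightarrow> w i - ?W / ?n) (at_left 1)"
    by simp
  then show ?thesis
  proof (rule Lim_transform_eventually)
    show "\<forall>\<^sub>F \<rho> in at_left 1.
        sqrt \<rho> * z * (sqrt (1 - \<rho>) / (1 + (?n - 1) * \<rho>)) + (w i - \<rho> / (1 + (?n - 1) * \<rho>) * ?W)
        = shrunk_dev \<rho> (obs 0 \<rho> z w) i / sqrt (1 - \<rho>)"
      using eventually_at_left_1
    proof eventually_elim
      case (elim \<rho>)
      define s where "s = sqrt (1 - \<rho>)"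
      define a where "a = 1 + (?n - 1) * \<rho>"
      have a: "a > 0"
        unfolding a_def by (rule equicorrelation_denom_pos [OF card_type_ge_1]) (use elim in auto)
      have s: "s > 0" and ss: "s * s = 1 - \<rho>"
        using elim by (auto simp: s_def)
      have "shrunk_dev \<rho> (obs 0 \<rho> z w) i
          = sqrt \<rho> * z + s * w i - \<rho> / a * (?n * (sqrt \<rho> * z) + s * ?W)"
        by (simp add: shrunk_dev_def obs_def sum.distrib sum_distrib_left s_def a_def)
      also have "\<dots> = sqrt \<rho> * z * (1 - \<rho> / a * ?n) + s * (w i - \<rho> / a * ?W)"
        by (simp add: algebra_simps)
      also have "1 - \<rho> / a * ?n = s * s / a"
        using a unfolding ss by (simp add: field_simps) (simp add: a_def algebra_simps)
      also have "(sqrt \<rho> * z * (s * s / a) + s * (w i - \<rho> / a * ?W)) / s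
          = sqrt \<rho> * z * (s / a) + (w i - \<rho> / a * ?W)"
        using s by (simp add: add_divide_distrib)
      finally show ?case
        unfolding s_def a_def by simp
    qed
  qed
qed

section \<open>Posterior consistency\<close>

lemma tendsto_posterior:
  fixes x :: "real \<Rightarrow> real ^ 'n::finite"
  assumes n: "2 \<le> CARD('n)" and r: "0 < r" "r < 1"
    and lim: "\<And>m. ((\<lambda>\<rho>. bayes_factor \<tau> \<rho> (x \<rho>) m / bayes_factor \<tau> \<rho> (x \<rho>) j) \<longlongrightarrow> l m) (at_left 1)"
    and l: "(\<Sum>m\<in>UNIV. l m * prior r m) \<noteq> 0"
  shows "((\<lambda>\<rho>. posterior r \<tau> \<rho> (x \<rho>) i)
           \<longlongrightarrow> l i * prior r i / (\<Sum>m\<in>UNIV. l m * prior r m)) (at_left 1)"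
proof -
  let ?v = "\<lambda>m \<rho>. bayes_factor \<tau> \<rho> (x \<rho>) m * prior r m"
  have p: "prior r m \<noteq> 0" for m :: "'n option"
    using r by (auto simp: prior_def split: option.splits)
  have "((\<lambda>\<rho>. ?v i \<rho> / (\<Sum>m\<in>UNIV. ?v m \<rho>))
      \<longlongrightarrow> (l i * prior r i / prior r j) / (\<Sum>m\<in>UNIV. l m * prior r m / prior r j)) (at_left 1)"
  proof (rule tendsto_normalized_weights [where j = j])
    fix m
    have "((\<lambda>\<rho>. bayes_factor \<tau> \<rho> (x \<rho>) m / bayes_factor \<tau> \<rho> (x \<rho>) j * prior r m / prior r j)
        \<longlongrightarrow> l m * prior r m / prior r j) (at_left 1)"
      by (intro tendsto_intros lim p)
    then show "((\<lambda>\<rho>. ?v m \<rho> / ?v j \<rho>) \<longlongrightarrow> l m * prior r m / prior r j) (at_left 1)"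
      by simp
    show "\<forall>\<^sub>F \<rho> in at_left 1. ?v j \<rho> \<noteq> 0"
      using eventually_at_left_1
    proof eventually_elim
      case (elim \<rho>)
      then show ?case
        using p bayes_factor_pos [OF n, of \<rho> \<tau> "x \<rho>" j] by simp
    qed
    show "(\<Sum>m\<in>UNIV. l m * prior r m / prior r j) \<noteq> 0"
      using l p by (simp add: sum_divide_distrib [symmetric])
  qed
  then have "((\<lambda>\<rho>. ?v i \<rho> / (\<Sum>m\<in>UNIV. ?v m \<rho>))
      \<longlongrightarrow> l i * prior r i / (\<Sum>m\<in>UNIV. l m * prior r m)) (at_left 1)"
    using p by (simp add: sum_divide_distrib [symmetric])
  then show ?thesis
    by (rule Lim_transform_eventually)
      (use eventually_at_left_1 in eventually_elim, simp add: posterior_eq_bayes_factor [OF n])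
qed

lemma tendsto_posterior_dominant_model:
  fixes x :: "real \<Rightarrow> real ^ 'n::finite"
  assumes n: "2 \<le> CARD('n)" and r: "0 < r" "r < 1"
    and lim: "\<And>m. ((\<lambda>\<rho>. bayes_factor \<tau> \<rho> (x \<rho>) m / bayes_factor \<tau> \<rho> (x \<rho>) j)
                 \<longlongrightarrow> (if m = j then 1 else 0)) (at_left 1)"
  shows "((\<lambda>\<rho>. posterior r \<tau> \<rho> (x \<rho>) i) \<longlongrightarrow> (if i = j then 1 else 0)) (at_left 1)"
proof -
  have p: "prior r j \<noteq> 0"
    using r by (auto simp: prior_def split: option.splits)
  have S: "(\<Sum>m\<in>UNIV. (if m = j then 1 else 0) * prior r m) = prior r j"
    by (simp add: if_distrib [of "\<lambda>c. c * _"] cong: if_cong)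
  have "((\<lambda>\<rho>. posterior r \<tau> \<rho> (x \<rho>) i)
      \<longlongrightarrow> (if i = j then 1 else 0) * prior r i / (\<Sum>m\<in>UNIV. (if m = j then 1 else 0) * prior r m)) (at_left 1)"
    by (rule tendsto_posterior [OF n r lim]) (simp add: S p)
  then show ?thesis
    using p by (auto simp: S)
qed

lemma bayes_factor_self_ratio:
  fixes x :: "real \<Rightarrow> real ^ 'n::finite"
  assumes n: "2 \<le> CARD('n)"
  shows "((\<lambda>\<rho>. bayes_factor \<tau> \<rho> (x \<rho>) m / bayes_factor \<tau> \<rho> (x \<rho>) m) \<longlongrightarrow> 1) (at_left 1)"
proof (rule Lim_transform_eventually [OF tendsto_const])
  show "\<forall>\<^sub>F \<rho> in at_left 1. 1 = bayes_factor \<tau> \<rho> (x \<rho>) m / bayes_factor \<tau> \<rho> (x \<rho>) m"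
    using eventually_at_left_1
  proof eventually_elim
    case (elim \<rho>)
    then show ?case
      using bayes_factor_pos [OF n, of \<rho> \<tau> "x \<rho>" m] by simp
  qed
qed

lemma posterior_consistent_null:
  fixes \<theta> :: "real ^ 'n::finite"
  assumes n: "2 \<le> CARD('n)" and r: "0 < r" "r < 1" and \<tau>: "\<tau>\<^sup>2 > 0"
    and \<theta>: "model_true None \<theta>"
  shows "((\<lambda>\<rho>. posterior r \<tau> \<rho> (obs \<theta> \<rho> z w) i) \<longlongrightarrow> (if i = None then 1 else 0)) (at_left 1)"
proof (rule tendsto_posterior_dominant_model [OF n r])
  fix m :: "'n option"
  have "\<theta> = 0" using \<theta> by (simp add: model_true_def)
  then have "((\<lambda>\<rho>. bayes_factor \<tau> \<rho> (obs \<theta> \<rho> z w) (Some k)) \<longlongrightarrow> 0) (at_left 1)" for k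
    using bayes_factor_tendsto_0 [OF n \<tau> tendsto_shrunk_dev_null] by simp
  then show "((\<lambda>\<rho>. bayes_factor \<tau> \<rho> (obs \<theta> \<rho> z w) m / bayes_factor \<tau> \<rho> (obs \<theta> \<rho> z w) None)
      \<longlongrightarrow> (if m = None then 1 else 0)) (at_left 1)"
    by (cases m) (simp_all add: bayes_factor_def [of _ _ _ None])
qed

lemma tendsto_shrunk_dev_model:
  fixes \<theta> :: "real ^ 'n::finite"
  assumes \<theta>: "model_true (Some j) \<theta>"
  shows "((\<lambda>\<rho>. shrunk_dev \<rho> (obs \<theta> \<rho> z w) i)
           \<longlongrightarrow> (if i = j then 1 - 1 / real CARD('n) else - 1 / real CARD('n)) * \<theta> $ j) (at_left 1)"
proof -
  have 0: "\<theta> $ k = 0" if "k \<noteq> j" for k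
    using \<theta> that by (simp add: model_true_def)
  then have "(\<Sum>k\<in>UNIV. \<theta> $ k) = \<theta> $ j"
    by (subst sum.remove [of _ j]) auto
  then show ?thesis
    using tendsto_shrunk_dev_obs [of \<theta> z w i] 0 by (auto simp: algebra_simps split: if_splits)
qed

text \<open>
  Every alternative beats the null model, not only the true one: centring spreads the single
  nonzero mean over all coordinates.
\<close>

lemma null_ratio_tendsto_0:
  fixes \<theta> :: "real ^ 'n::finite"
  assumes n: "2 \<le> CARD('n)" and \<tau>: "\<tau>\<^sup>2 > 0" and \<theta>: "model_true (Some j) \<theta>"
  shows "((\<lambda>\<rho>. bayes_factor \<tau> \<rho> (obs \<theta> \<rho> z w) None / bayes_factor \<tau> \<rho> (obs \<theta> \<rho> z w) (Some i))
           \<longlongrightarrow> 0) (at_left 1)"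
proof -
  have "(if i = j then 1 - 1 / real CARD('n) else - 1 / real CARD('n)) * \<theta> $ j \<noteq> 0"
    using n \<theta> by (auto simp: model_true_def)
  from inverse_bayes_factor_tendsto_0 [OF n \<tau> tendsto_shrunk_dev_model [OF \<theta>] this]
  show ?thesis
    by (simp add: bayes_factor_def [of _ _ _ None] divide_inverse)
qed

lemma posterior_consistent_alternative:
  fixes \<theta> :: "real ^ 'n::finite"
  assumes n: "2 < CARD('n)" and r: "0 < r" "r < 1" and \<tau>: "\<tau>\<^sup>2 > 0"
    and \<theta>: "model_true (Some j) \<theta>"
  shows "((\<lambda>\<rho>. posterior r \<tau> \<rho> (obs \<theta> \<rho> z w) i) \<longlongrightarrow> (if i = Some j then 1 else 0)) (at_left 1)"
proof -
  have n2: "2 \<le> CARD('n)" using n by simp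
  show ?thesis
  proof (rule tendsto_posterior_dominant_model [OF n2 r])
    fix m :: "'n option"
    show "((\<lambda>\<rho>. bayes_factor \<tau> \<rho> (obs \<theta> \<rho> z w) m / bayes_factor \<tau> \<rho> (obs \<theta> \<rho> z w) (Some j))
        \<longlongrightarrow> (if m = Some j then 1 else 0)) (at_left 1)"
    proof (cases m)
      case None
      then show ?thesis using null_ratio_tendsto_0 [OF n2 \<tau> \<theta>] by simp
    next
      case (Some k)
      show ?thesis
      proof (cases "k = j")
        case True
        then show ?thesis using Some bayes_factor_self_ratio [OF n2] by simp
      next
        case False
        let ?N = "real CARD('n)"
        have "1 / ?N < 1 - 1 / ?N" "0 < 1 / ?N" using n by (simp_all add: field_simps)
        then have "(1 / ?N)\<^sup>2 < (1 - 1 / ?N)\<^sup>2"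
          by (intro power_strict_mono) auto
        moreover have "0 < (\<theta> $ j)\<^sup>2" using \<theta> by (simp add: model_true_def)
        ultimately have less: "((- 1 / ?N) * \<theta> $ j)\<^sup>2 < ((1 - 1 / ?N) * \<theta> $ j)\<^sup>2"
          unfolding power_mult_distrib by (intro mult_strict_right_mono) (simp_all add: power_divide)
        have dk: "((\<lambda>\<rho>. shrunk_dev \<rho> (obs \<theta> \<rho> z w) k) \<longlongrightarrow> (- 1 / ?N) * \<theta> $ j) (at_left 1)"
          using tendsto_shrunk_dev_model [OF \<theta>, of z w k] False by simp
        have dj: "((\<lambda>\<rho>. shrunk_dev \<rho> (obs \<theta> \<rho> z w) j) \<longlongrightarrow> (1 - 1 / ?N) * \<theta> $ j) (at_left 1)"
          using tendsto_shrunk_dev_model [OF \<theta>, of z w j] by simp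
        show ?thesis
          using bayes_factor_ratio_tendsto_0 [OF n2 \<tau> dk dj less] Some False by simp
      qed
    qed
  qed
qed

text \<open>
  The null model drops out and the two alternatives have equal priors, so the limit is the one of
  \<open>1 / (1 + B\<^sub>k / B\<^sub>i)\<close>.
\<close>

lemma posterior_pair_limit:
  fixes \<theta> :: "real ^ 'n::finite"
  assumes n: "CARD('n) = 2" and r: "0 < r" "r < 1" and \<tau>: "\<tau>\<^sup>2 > 0"
    and \<theta>: "model_true (Some j) \<theta>" and ki: "k \<noteq> i"
  shows "((\<lambda>\<rho>. posterior r \<tau> \<rho> (obs \<theta> \<rho> z w) (Some i))
           \<longlongrightarrow> inverse (1 + exp (((\<theta> $ k + z)\<^sup>2 - (\<theta> $ i + z)\<^sup>2) / 2))) (at_left 1)"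
proof -
  have n2: "2 \<le> CARD('n)" using n by simp
  define E where "E = exp (((\<theta> $ k + z)\<^sup>2 - (\<theta> $ i + z)\<^sup>2) / 2)"
  define l where "l m = (case m of None \<Rightarrow> 0 | Some h \<Rightarrow> if h = i then 1 else E)" for m
  have "{k, i} = (UNIV :: 'n set)"
    by (rule card_subset_eq) (use n ki in auto)
  then have U: "(UNIV :: 'n set) = {i, k}" by auto
  have p: "prior r (Some h) = (1 - r) / 2" for h :: 'n
    by (simp add: prior_def n)
  have S: "(\<Sum>m\<in>UNIV. l m * prior r m) = (1 + E) * ((1 - r) / 2)"
    using ki by (simp add: UNIV_option_conv U l_def p sum.reindex distrib_right)
  have E: "1 + E > 0" by (simp add: E_def add_pos_pos)
  have lim: "((\<lambda>\<rho>. bayes_factor \<tau> \<rho> (obs \<theta> \<rho> z w) m / bayes_factor \<tau> \<rho> (obs \<theta> \<rho> z w) (Some i))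
      \<longlongrightarrow> l m) (at_left 1)" for m
  proof (cases m)
    case None
    then show ?thesis using null_ratio_tendsto_0 [OF n2 \<tau> \<theta>] by (simp add: l_def)
  next
    case (Some h)
    then consider "h = i" | "h = k" using U by auto
    then show ?thesis
    proof cases
      case 1
      then show ?thesis using Some bayes_factor_self_ratio [OF n2] by (simp add: l_def)
    next
      case 2
      then show ?thesis
        using Some ki bayes_factor_ratio_pair [OF n \<tau> ki tendsto_obs tendsto_obs, of \<theta> z w]
        by (simp add: l_def E_def)
    qed
  qed
  have "((\<lambda>\<rho>. posterior r \<tau> \<rho> (obs \<theta> \<rho> z w) (Some i))
      \<longlongrightarrow> l (Some i) * prior r (Some i) / (\<Sum>m\<in>UNIV. l m * prior r m)) (at_left 1)"
    by (rule tendsto_posterior [OF n2 r lim]) (use S E r in auto)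
  moreover have "l (Some i) * prior r (Some i) / (\<Sum>m\<in>UNIV. l m * prior r m) = inverse (1 + E)"
  proof -
    have "q / ((1 + E) * q) = inverse (1 + E)" if "q \<noteq> 0" for q
      using that by (simp add: inverse_eq_divide)
    from this [of "(1 - r) / 2"] show ?thesis
      unfolding S p using r by (simp only: l_def option.case if_True mult_1) simp
  qed
  ultimately show ?thesis by (simp add: E_def)
qed

text \<open>
  The comparison function in terms of the observed coordinates has the same limit as the posterior
  probability, because each coordinate converges to \<open>\<theta>\<^sub>i + z\<close>.
\<close>

lemma posterior_pair_asymp:
  fixes \<theta> :: "real ^ 'n::finite"
  assumes n: "CARD('n) = 2" and r: "0 < r" "r < 1" and \<tau>: "\<tau>\<^sup>2 > 0"
    and \<theta>: "model_true (Some j) \<theta>" and ki: "k \<noteq> i"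
  shows "((\<lambda>\<rho>. posterior r \<tau> \<rho> (obs \<theta> \<rho> z w) (Some i)
            - inverse (1 + exp (- (1 / 2) * ((obs \<theta> \<rho> z w $ i)\<^sup>2 - (obs \<theta> \<rho> z w $ k)\<^sup>2)))) \<longlongrightarrow> 0)
         (at_left 1)"
proof -
  let ?L = "inverse (1 + exp (((\<theta> $ k + z)\<^sup>2 - (\<theta> $ i + z)\<^sup>2) / 2))"
  have "((\<lambda>\<rho>. inverse (1 + exp (- (1 / 2) * ((obs \<theta> \<rho> z w $ i)\<^sup>2 - (obs \<theta> \<rho> z w $ k)\<^sup>2))))
      \<longlongrightarrow> inverse (1 + exp (- (1 / 2) * ((\<theta> $ i + z)\<^sup>2 - (\<theta> $ k + z)\<^sup>2)))) (at_left 1)"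
    by (intro tendsto_intros tendsto_obs) (metis add_pos_pos exp_gt_zero less_numeral_extra(1,3))
  moreover have "- (1 / 2) * ((\<theta> $ i + z)\<^sup>2 - (\<theta> $ k + z)\<^sup>2) = ((\<theta> $ k + z)\<^sup>2 - (\<theta> $ i + z)\<^sup>2) / 2"
    by (simp add: field_simps)
  ultimately have "((\<lambda>\<rho>. inverse (1 + exp (- (1 / 2) * ((obs \<theta> \<rho> z w $ i)\<^sup>2 - (obs \<theta> \<rho> z w $ k)\<^sup>2))))
      \<longlongrightarrow> ?L) (at_left 1)"
    by (simp only:)
  from tendsto_diff [OF posterior_pair_limit [OF assms, of z w] this] show ?thesis
    by (simp only: diff_self)
qed

theorem theorem4p1:
  fixes M :: "'a measure" and Z :: "'a \<Rightarrow> real" and W :: "'n::finite \<Rightarrow> 'a \<Rightarrow> real"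
    and r \<tau> :: real and \<theta> :: "real ^ 'n"
  assumes "prob_space M"
    and "distributed M lborel Z (\<lambda>x. ennreal (std_normal_density x))"
    and "\<And>i. distributed M lborel (W i) (\<lambda>x. ennreal (std_normal_density x))"
    and "prob_space.indep_vars M (\<lambda>_. borel)
           (\<lambda>k. case k of None \<Rightarrow> Z | Some i \<Rightarrow> W i) (UNIV :: 'n option set)"
    and "0 < r" and "r < 1" and "\<tau>\<^sup>2 > 0"
  defines "X \<equiv> \<lambda>\<rho> \<omega>. obs \<theta> \<rho> (Z \<omega>) (\<lambda>i. W i \<omega>)"
  shows
    "(CARD('n) = 2 \<longrightarrow>
        (model_true None \<theta> \<longrightarrow>
           (AE \<omega> in M. ((\<lambda>\<rho>. posterior r \<tau> \<rho> (X \<rho> \<omega>) None) \<longlongrightarrow> 1) (at_left 1))) \<and>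
        ((\<exists>j. model_true (Some j) \<theta>) \<longrightarrow>
           (\<forall>i k. k \<noteq> i \<longrightarrow>
              (AE \<omega> in M. ((\<lambda>\<rho>. posterior r \<tau> \<rho> (X \<rho> \<omega>) (Some i)
                   - inverse (1 + exp (- (1 / 2) * ((X \<rho> \<omega> $ i)\<^sup>2 - (X \<rho> \<omega> $ k)\<^sup>2)))) \<longlongrightarrow> 0)
                 (at_left 1))))) \<and>
     (CARD('n) > 2 \<longrightarrow>
        (\<forall>i j. model_true j \<theta> \<longrightarrow>
           (AE \<omega> in M. ((\<lambda>\<rho>. posterior r \<tau> \<rho> (X \<rho> \<omega>) i) \<longlongrightarrow> (if i = j then 1 else 0))
              (at_left 1))))"
proof (intro conjI impI allI AE_I2)
  fix \<omega>
  assume n: "CARD('n) = 2" and \<theta>: "model_true None \<theta>"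
  have "2 \<le> CARD('n)" using n by simp
  from posterior_consistent_null [OF this assms(5-7) \<theta>, of "Z \<omega>" "\<lambda>i. W i \<omega>" None]
  show "((\<lambda>\<rho>. posterior r \<tau> \<rho> (X \<rho> \<omega>) None) \<longlongrightarrow> 1) (at_left 1)"
    by (simp only: X_def if_True simp_thms)
next
  fix i k :: 'n and \<omega>
  assume n: "CARD('n) = 2" and "\<exists>j. model_true (Some j) \<theta>" and ki: "k \<noteq> i"
  then obtain j where \<theta>: "model_true (Some j) \<theta>" by blast
  show "((\<lambda>\<rho>. posterior r \<tau> \<rho> (X \<rho> \<omega>) (Some i)
      - inverse (1 + exp (- (1 / 2) * ((X \<rho> \<omega> $ i)\<^sup>2 - (X \<rho> \<omega> $ k)\<^sup>2)))) \<longlongrightarrow> 0) (at_left 1)"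
    unfolding X_def by (rule posterior_pair_asymp [OF n assms(5-7) \<theta> ki])
next
  fix i j :: "'n option" and \<omega>
  assume n: "2 < CARD('n)" and \<theta>: "model_true j \<theta>"
  show "((\<lambda>\<rho>. posterior r \<tau> \<rho> (X \<rho> \<omega>) i) \<longlongrightarrow> (if i = j then 1 else 0)) (at_left 1)"
  proof (cases j)
    case None
    then show ?thesis
      unfolding X_def using posterior_consistent_null [OF less_imp_le [OF n] assms(5-7)] \<theta> by blast
  next
    case (Some h)
    then show ?thesis
      unfolding X_def using posterior_consistent_alternative [OF n assms(5-7)] \<theta> by blast
  qed
qed

end
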